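(* Let $d\ge1$ and $0<\alpha<1$. Let $u_0\ge0$ be bounded, integrable, not identically zero and radially non-increasing on $\mathbb R^d$, let $M=\|u_0\|_{L^1(\mathbb R^d)}$, let $u$ be the solution by characteristics with rarefaction fans with datum $u_0$ (defined in the context), and let $$U_M(t,x)=t^{-\frac1\alpha}\left(\alpha+\left(\frac{\omega_d|x|^d\,t^{-\frac1\alpha}}{\alpha M}\right)^{\frac\alpha{1-\alpha}}\right)^{-\frac1\alpha}.$$ Let $\omega_d|x|^d=\rho=\rho_0+\alpha\,m_0(\rho_0)\,\eta_0^{\alpha-1}\,t$. Then $$\frac{u(t,x)^\alpha-U_M(t,x)^\alpha}{U_M(t,x)^\alpha}=\left[1-\left(\frac{\rho/(\rho-\rho_0)}{M/m_0(\rho_0)}\right)^{\frac\alpha{1-\alpha}}\right]\left[1+\alpha\left(\frac{\rho-\rho_0}{\alpha\,m_0(\rho_0)\,t^{\frac1\alpha}}\right)^{-\frac\alpha{1-\alpha}}\right]^{-1}.$$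
   Context: $\omega_d$ is the volume of the unit ball of $\mathbb R^d$; radial functions on $\mathbb R^d$ are identified with functions of the volume variable $\rho=\omega_d|x|^d\ge0$, and $m_0(\rho)=\int_0^\rho u_0(s)\,ds$. For $t>0$, the solution by characteristics with rarefaction fans with datum $u_0$ is $u(t,\rho)=(\eta_0^{-\alpha}+\alpha t)^{-1/\alpha}$, where $(\rho_0,\eta_0)$ is the pair, with $\eta_0\in[u_0(\rho_0^+),u_0(\rho_0^-)]$ (one-sided limits of $u_0$), determined by $\rho=\rho_0+\alpha\,m_0(\rho_0)\,\eta_0^{\alpha-1}\,t$. The same pair $(\rho_0,\eta_0)$ is the one appearing in the claim.
   Formalization: The identity as printed has a sign error; the formal statement has an additional leading minus sign on the right-hand side, and it is stated for x ≠ 0, since at x = 0 the right-hand side contains 0/0. *)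

theory Defs
  imports "HOL-Analysis.Analysis"
begin

text \<open>The volume variable \<open>\<rho> = \<omega>\<^sub>d |x|^d\<close> on a \<open>d\<close>-dimensional Euclidean space.\<close>

definition vol_var :: "'a::euclidean_space \<Rightarrow> real" where
  "vol_var x = measure lebesgue (ball (0::'a) 1) * norm x ^ DIM('a)"

definition radially_nonincreasing :: "('a::euclidean_space \<Rightarrow> real) \<Rightarrow> bool" where
  "radially_nonincreasing u0 \<longleftrightarrow> (\<forall>x y. norm x \<le> norm y \<longrightarrow> u0 y \<le> u0 x)"

text \<open>A radial function as a function of the volume variable. For radial \<open>u0\<close> and \<open>\<rho> \<ge> 0\<close> the
  value does not depend on the choice of \<open>x\<close>; for \<open>\<rho> < 0\<close> no such \<open>x\<close> exists and the value is
  meaningless.\<close>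

definition radial_profile :: "('a::euclidean_space \<Rightarrow> real) \<Rightarrow> real \<Rightarrow> real" where
  "radial_profile u0 \<rho> = u0 (SOME x. vol_var x = \<rho>)"

text \<open>In the following definitions \<open>f\<close> is the datum as a function of the volume variable.\<close>

definition mass0 :: "(real \<Rightarrow> real) \<Rightarrow> real \<Rightarrow> real" where
  "mass0 f \<rho> = (LINT s:{0..\<rho>}|lebesgue. f s)"

definition right_lim :: "(real \<Rightarrow> real) \<Rightarrow> real \<Rightarrow> real" where
  "right_lim f \<rho> = Lim (at_right \<rho>) f"

text \<open>The domain of \<open>f\<close> is \<open>[0, \<infinity>)\<close>; at its left end point the value \<open>f(0\<^sup>-)\<close> is read as
  \<open>f(0\<^sup>+)\<close>.\<close>

definition left_lim :: "(real \<Rightarrow> real) \<Rightarrow> real \<Rightarrow> real" where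
  "left_lim f \<rho> = (if \<rho> = 0 then right_lim f 0 else Lim (at_left \<rho>) f)"

text \<open>\<open>(\<rho>\<^sub>0, \<eta>\<^sub>0)\<close> is the foot and the initial value of a characteristic, or of a line of a
  rarefaction fan issued from a jump of \<open>f\<close>, that passes through \<open>\<rho>\<close> at time \<open>t\<close>. For
  \<open>\<alpha> < 1\<close> the expression \<open>\<eta>\<^sub>0 powr (\<alpha> - 1)\<close> is a real number only for \<open>\<eta>\<^sub>0 > 0\<close>, which has to be
  required since \<open>0 powr a = 0\<close> in the library.\<close>

definition charac_pair ::
  "real \<Rightarrow> (real \<Rightarrow> real) \<Rightarrow> real \<Rightarrow> real \<Rightarrow> real \<Rightarrow> real \<Rightarrow> bool" where
  "charac_pair \<alpha> f t \<rho> \<rho>\<^sub>0 \<eta>\<^sub>0 \<longleftrightarrow>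
     0 \<le> \<rho>\<^sub>0 \<and> 0 < \<eta>\<^sub>0 \<and> \<eta>\<^sub>0 \<in> {right_lim f \<rho>\<^sub>0 .. left_lim f \<rho>\<^sub>0} \<and>
     \<rho> = \<rho>\<^sub>0 + \<alpha> * mass0 f \<rho>\<^sub>0 * \<eta>\<^sub>0 powr (\<alpha> - 1) * t"

definition charac_solution :: "real \<Rightarrow> (real \<Rightarrow> real) \<Rightarrow> real \<Rightarrow> real \<Rightarrow> real" where
  "charac_solution \<alpha> f t \<rho> =
     (case (THE p. charac_pair \<alpha> f t \<rho> (fst p) (snd p)) of
       (\<rho>\<^sub>0, \<eta>\<^sub>0) \<Rightarrow> (\<eta>\<^sub>0 powr (-\<alpha>) + \<alpha> * t) powr (-1 / \<alpha>))"

definition source_solution :: "real \<Rightarrow> real \<Rightarrow> real \<Rightarrow> 'a::euclidean_space \<Rightarrow> real" where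
  "source_solution \<alpha> M t x =
     t powr (-1 / \<alpha>) *
     (\<alpha> + (vol_var x * t powr (-1 / \<alpha>) / (\<alpha> * M)) powr (\<alpha> / (1 - \<alpha>))) powr (-1 / \<alpha>)"

end

theory Submission
  imports Defs
begin

text \<open>Characteristics do not cross: since the profile is non-increasing, moving the foot \<open>\<rho>\<^sub>0\<close> to the
  right decreases \<open>\<eta>\<^sub>0\<close> and hence increases \<open>\<eta>\<^sub>0 powr (\<alpha> - 1)\<close>, so the pair \<open>(\<rho>\<^sub>0, \<eta>\<^sub>0)\<close> is unique
  and \<open>u\<close> is given by it. With \<open>X = (\<rho> - \<rho>\<^sub>0) / (\<alpha> m\<^sub>0 t powr (1 / \<alpha>))\<close>,
  \<open>Y = \<rho> / (\<alpha> M t powr (1 / \<alpha>))\<close> and \<open>\<gamma> = \<alpha> / (1 - \<alpha>)\<close>, one then has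
  \<open>\<eta>\<^sub>0 powr (-\<alpha>) = t X powr \<gamma>\<close>, so that the ratio of \<open>u powr \<alpha>\<close> to \<open>U powr \<alpha>\<close> is
  \<open>(\<alpha> + Y powr \<gamma>) / (\<alpha> + X powr \<gamma>)\<close>.\<close>

lemma vol_var_pos:
  fixes x :: "'a::euclidean_space"
  assumes "x \<noteq> 0"
  shows "0 < vol_var x"
  using assms content_ball_pos[of 1 "0::'a"] by (simp add: vol_var_def)

lemma vol_var_surj:
  assumes "0 \<le> \<rho>"
  obtains x :: "'a::euclidean_space" where "vol_var x = \<rho>"
proof -
  define w where "w = measure lebesgue (ball (0::'a) 1)"
  define r where "r = root DIM('a) (\<rho> / w)"
  have w: "0 < w" using content_ball_pos[of 1 "0::'a"] by (simp add: w_def)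
  obtain b :: 'a where b: "b \<in> Basis" using nonempty_Basis by blast
  have "vol_var (r *\<^sub>R b) = w * r ^ DIM('a)"
    using b w assms by (simp add: vol_var_def w_def[symmetric] r_def)
  also have "\<dots> = \<rho>" using w assms by (simp add: r_def)
  finally show ?thesis using that by blast
qed

lemma norm_le_of_vol_var_le:
  fixes x y :: "'a::euclidean_space"
  assumes "vol_var x \<le> vol_var y"
  shows "norm x \<le> norm y"
proof -
  have "norm x ^ DIM('a) \<le> norm y ^ DIM('a)"
    using assms content_ball_pos[of 1 "0::'a"] by (simp add: vol_var_def)
  then show ?thesis by (simp add: power_mono_iff)
qed

text \<open>The choice in \<open>radial_profile\<close> meets its specification because
  \<open>vol_var\<close> takes every nonnegative value; a larger volume then forces a larger
  norm.\<close>

lemma antimono_on_radial_profile: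
  fixes u0 :: "'a::euclidean_space \<Rightarrow> real"
  assumes "radially_nonincreasing u0"
  shows "antimono_on {0..} (radial_profile u0)"
proof (rule monotone_onI)
  fix r s :: real assume rs: "r \<in> {0..}" "s \<in> {0..}" "r \<le> s"
  have vol: "vol_var (SOME x::'a. vol_var x = q) = q" if "0 \<le> q" for q
    using vol_var_surj[OF that] by (metis (mono_tags, lifting) someI)
  have "norm (SOME x::'a. vol_var x = r) \<le> norm (SOME x::'a. vol_var x = s)"
    by (rule norm_le_of_vol_var_le) (use rs vol in simp)
  then show "radial_profile u0 s \<le> radial_profile u0 r"
    using assms by (simp add: radially_nonincreasing_def radial_profile_def)
qed

text \<open>\<open>Lim\<close> is a definite description, so the one-sided limit must first be shown
  to exist. Negating \<open>f\<close> makes it non-decreasing, with \<open>- f \<rho>\<close> as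
  lower bound to the right of \<rho>.\<close>

lemma le_right_lim:
  assumes f: "antimono_on {0..} f" and "0 \<le> \<rho>" "\<rho> < s"
  shows "f s \<le> right_lim f \<rho>"
proof -
  have "((\<lambda>r. - f r) \<longlongrightarrow> Inf ((\<lambda>r. - f r) ` ({\<rho><..} \<inter> UNIV))) (at \<rho> within ({\<rho><..} \<inter> UNIV))"
    by (rule Lim_right_bound[where K = "- f \<rho>"]) (use assms in \<open>auto intro!: monotone_onD[OF f]\<close>)
  from tendsto_minus[OF this] obtain L where L: "(f \<longlongrightarrow> L) (at_right \<rho>)" by auto
  have "eventually (\<lambda>r. f s \<le> f r) (at_right \<rho>)"
    using eventually_at_right_real[OF \<open>\<rho> < s\<close>]
    by eventually_elim (use assms in \<open>auto intro!: monotone_onD[OF f]\<close>)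
  with L have "f s \<le> L" by (rule tendsto_lowerbound) simp
  moreover have "right_lim f \<rho> = L"
    unfolding right_lim_def using L by (intro tendsto_Lim) auto
  ultimately show ?thesis by simp
qed

lemma left_lim_le:
  assumes f: "antimono_on {0..} f" and "0 \<le> s" "s < \<rho>"
  shows "left_lim f \<rho> \<le> f s"
proof -
  have "((\<lambda>r. - f r) \<longlongrightarrow> Sup ((\<lambda>r. - f r) ` ({..<\<rho>} \<inter> {0..}))) (at \<rho> within ({..<\<rho>} \<inter> {0..}))"
    by (rule Lim_left_bound[where K = "- f \<rho>"]) (use assms in \<open>auto intro!: monotone_onD[OF f]\<close>)
  \<comment> \<open>Monotonicity is known only on the nonnegative reals; since 0 \<le>
    \<open>s\<close> < \<rho>, that restriction is invisible near \<rho>.\<close>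
  moreover have "at \<rho> within ({..<\<rho>} \<inter> {0..}) = at_left \<rho>"
    by (rule at_within_nhd[where S = "{s<..}"]) (use assms in auto)
  ultimately obtain L' where "((\<lambda>r. - f r) \<longlongrightarrow> L') (at_left \<rho>)" by auto
  from tendsto_minus[OF this] obtain L where L: "(f \<longlongrightarrow> L) (at_left \<rho>)" by auto
  have "eventually (\<lambda>r. f r \<le> f s) (at_left \<rho>)"
    using eventually_at_left_real[OF \<open>s < \<rho>\<close>]
    by eventually_elim (use assms in \<open>auto intro!: monotone_onD[OF f]\<close>)
  with L have "L \<le> f s" by (rule tendsto_upperbound) simp
  moreover have "left_lim f \<rho> = L"
    unfolding left_lim_def using L assms by (auto intro!: tendsto_Lim)
  ultimately show ?thesis by simp
qed

lemma integrable_on_antimono_on: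
  fixes f :: "real \<Rightarrow> real"
  assumes "antimono_on {a..b} f"
  shows "f integrable_on {a..b}"
proof -
  have "mono_on {a..b} (\<lambda>s. - f s)" using assms by (auto simp: monotone_on_def)
  then have "(\<lambda>s. - f s) integrable_on {a..b}" by (rule integrable_on_mono_on)
  then show ?thesis by (simp add: integrable_neg_iff)
qed

text \<open>Monotonicity gives gauge integrability and nonnegativity makes it absolute, so the
  Lebesgue integral in \<open>mass0\<close> equals the gauge integral.\<close>

lemma mass0_eq_integral:
  assumes "antimono_on {0..} f" and "\<And>s. 0 \<le> f s"
  shows "f integrable_on {0..\<rho>}" and "mass0 f \<rho> = integral {0..\<rho>} f"
proof -
  show int: "f integrable_on {0..\<rho>}"
    by (rule integrable_on_antimono_on) (use assms(1) in \<open>auto simp: monotone_on_def\<close>)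
  show "mass0 f \<rho> = integral {0..\<rho>} f"
    unfolding mass0_def
    by (intro set_lebesgue_integral_eq_integral(2) nonnegative_absolutely_integrable_1 int assms)
qed

lemma mass0_mono:
  assumes "antimono_on {0..} f" and "\<And>s. 0 \<le> f s" and "r \<le> s"
  shows "mass0 f r \<le> mass0 f s"
proof -
  have "integral {0..r} f \<le> integral {0..s} f"
    by (rule integral_subset_le) (use assms in \<open>auto intro!: mass0_eq_integral(1)\<close>)
  then show ?thesis using mass0_eq_integral(2)[OF assms(1,2)] by simp
qed

lemma mass0_pos:
  assumes f: "antimono_on {0..} f" and nonneg: "\<And>s. 0 \<le> f s"
    and "0 < \<rho>" and "0 < left_lim f \<rho>"
  shows "0 < mass0 f \<rho>"
proof -
  \<comment> \<open>Every point of [0, \<rho>/2] lies strictly below \<rho>, as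
    \<open>left_lim_le\<close> demands, so the left limit bounds \<open>f\<close> from below
    there.\<close>
  have "0 < \<rho> / 2 * left_lim f \<rho>" using assms by simp
  also have "\<dots> = integral {0..\<rho> / 2} (\<lambda>_. left_lim f \<rho>)" using \<open>0 < \<rho>\<close> by simp
  also have "\<dots> \<le> integral {0..\<rho> / 2} f"
    by (rule integral_le)
      (use mass0_eq_integral(1)[OF f nonneg] \<open>0 < \<rho>\<close> in \<open>auto intro!: left_lim_le[OF f]\<close>)
  also have "\<dots> = mass0 f (\<rho> / 2)" using f nonneg by (simp add: mass0_eq_integral)
  also have "\<dots> \<le> mass0 f \<rho>" by (rule mass0_mono) (use assms in auto)
  finally show ?thesis .
qed

text \<open>A foot at 0 carries no mass, so its characteristic stays at 0 and misses \<rho> > 0. At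
  a positive foot, 0 < \<open>e\<close> \<le> \<open>left_lim f r\<close> yields positive
  mass.\<close>

lemma charac_pair_pos:
  assumes "antimono_on {0..} f" and "\<And>s. 0 \<le> f s"
    and "0 < \<rho>" and "charac_pair \<alpha> f t \<rho> r e"
  shows "0 < r" and "0 < e" and "0 < mass0 f r"
proof -
  show "0 < e" using assms(4) by (simp add: charac_pair_def)
  have "mass0 f 0 = 0"
    using assms by (simp add: mass0_eq_integral)
  then show "0 < r"
    using assms(3,4) by (cases "r = 0") (auto simp: charac_pair_def)
  then show "0 < mass0 f r"
    using assms by (intro mass0_pos) (auto simp: charac_pair_def)
qed

lemma charac_pair_foot_le:
  assumes \<alpha>: "0 < \<alpha>" "\<alpha> < 1" and f: "antimono_on {0..} f" "\<And>s. 0 \<le> f s"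
    and "0 < t" "0 < \<rho>" and p: "charac_pair \<alpha> f t \<rho> r e" and q: "charac_pair \<alpha> f t \<rho> r' e'"
  shows "r' \<le> r"
proof (rule ccontr)
  assume "\<not> r' \<le> r"
  then have less: "r < r'" by simp
  note pos = charac_pair_pos[OF f \<open>0 < \<rho>\<close> p] charac_pair_pos[OF f \<open>0 < \<rho>\<close> q]
  have "e' \<le> left_lim f r'" using q by (simp add: charac_pair_def)
  \<comment> \<open>The midpoint lies strictly between the two feet, so both one-sided limits can be
    compared with the value of \<open>f\<close> there.\<close>
  also have "\<dots> \<le> f ((r + r') / 2)"
    by (rule left_lim_le) (use f pos less in auto)
  also have "\<dots> \<le> right_lim f r"
    by (rule le_right_lim) (use f pos less in auto)
  also have "\<dots> \<le> e" using p by (simp add: charac_pair_def)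
  finally have "e powr (\<alpha> - 1) \<le> e' powr (\<alpha> - 1)"
    using \<alpha> pos by (intro powr_mono2') auto
  moreover have "mass0 f r \<le> mass0 f r'"
    by (rule mass0_mono) (use f less in auto)
  ultimately have "\<alpha> * mass0 f r * e powr (\<alpha> - 1) * t \<le> \<alpha> * mass0 f r' * e' powr (\<alpha> - 1) * t"
    using \<alpha> pos \<open>0 < t\<close> by (intro mult_right_mono mult_mono mult_left_mono) auto
  \<comment> \<open>The foot further right also has at least as large a displacement, so the two
    lines cannot both reach \<rho> at time \<open>t\<close>.\<close>
  with less p q show False by (simp add: charac_pair_def)
qed

lemma charac_pair_unique:
  assumes \<alpha>: "0 < \<alpha>" "\<alpha> < 1" and f: "antimono_on {0..} f" "\<And>s. 0 \<le> f s"
    and "0 < t" "0 < \<rho>" and p: "charac_pair \<alpha> f t \<rho> r e" and q: "charac_pair \<alpha> f t \<rho> r' e'"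
  shows "r' = r \<and> e' = e"
proof -
  note foot = charac_pair_foot_le[OF \<alpha> f \<open>0 < t\<close> \<open>0 < \<rho>\<close>]
  have r: "r' = r" using foot[OF p q] foot[OF q p] by simp
  note pos = charac_pair_pos[OF f \<open>0 < \<rho>\<close> p] charac_pair_pos[OF f \<open>0 < \<rho>\<close> q]
  \<comment> \<open>With a common foot, the positive factor \<alpha> \<open>mass0 f r\<close>
    \<open>t\<close> cancels; the nonzero exponent \<alpha> - 1 can then be inverted.\<close>
  have "e powr (\<alpha> - 1) = e' powr (\<alpha> - 1)"
    using p q \<alpha> pos \<open>0 < t\<close> by (simp add: charac_pair_def r)
  then have "(e powr (\<alpha> - 1)) powr (1 / (\<alpha> - 1)) = (e' powr (\<alpha> - 1)) powr (1 / (\<alpha> - 1))"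
    by simp
  then show ?thesis using \<alpha> pos r by (simp add: powr_powr)
qed

lemma charac_solution_eq:
  assumes "0 < \<alpha>" "\<alpha> < 1" and "antimono_on {0..} f" "\<And>s. 0 \<le> f s"
    and "0 < t" "0 < \<rho>" and p: "charac_pair \<alpha> f t \<rho> r e"
  shows "charac_solution \<alpha> f t \<rho> = (e powr (-\<alpha>) + \<alpha> * t) powr (-1 / \<alpha>)"
proof -
  have "(THE p. charac_pair \<alpha> f t \<rho> (fst p) (snd p)) = (r, e)"
  proof (rule the_equality)
    fix q assume "charac_pair \<alpha> f t \<rho> (fst q) (snd q)"
    from charac_pair_unique[OF assms this] show "q = (r, e)" by (simp add: prod_eq_iff)
  qed (use p in simp)
  then show ?thesis by (simp add: charac_solution_def)
qed

text \<open>The factor \<alpha> \<open>m\<close> cancels in \<open>X\<close>. The exponent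
  \<alpha>/(1 - \<alpha>) then turns the power \<alpha> - 1 of \<open>e\<close> into -\<alpha> and
  the power 1 - 1/\<alpha> of \<open>t\<close> into -1.\<close>

lemma charac_slope_powr:
  fixes \<alpha> m e t \<delta> X :: real
  assumes \<alpha>: "0 < \<alpha>" "\<alpha> < 1" and pos: "0 < m" "0 < e" "0 < t"
    and \<delta>: "\<delta> = \<alpha> * m * e powr (\<alpha> - 1) * t" and X: "X = \<delta> / (\<alpha> * m * t powr (1 / \<alpha>))"
  shows "e powr (-\<alpha>) = t * X powr (\<alpha> / (1 - \<alpha>))"
proof -
  have "X = e powr (\<alpha> - 1) * t powr (1 - 1 / \<alpha>)"
    using \<alpha> pos by (simp add: X \<delta> powr_diff)
  then have "X powr (\<alpha> / (1 - \<alpha>)) =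
      e powr ((\<alpha> - 1) * (\<alpha> / (1 - \<alpha>))) * t powr ((1 - 1 / \<alpha>) * (\<alpha> / (1 - \<alpha>)))"
    using pos by (simp add: powr_mult powr_powr)
  also have "(\<alpha> - 1) * (\<alpha> / (1 - \<alpha>)) = - \<alpha>" using \<alpha> by (simp add: field_simps)
  also have "(1 - 1 / \<alpha>) * (\<alpha> / (1 - \<alpha>)) = - 1" using \<alpha> by (simp add: field_simps)
  finally show ?thesis using pos by (simp add: powr_minus field_simps)
qed

text \<open>The quotient of the reciprocals is (\<alpha> + \<open>B\<close>)/(\<open>A\<close> +
  \<alpha>); subtracting 1 leaves (\<open>B\<close> - \<open>A\<close>)/(\<open>A\<close> +
  \<alpha>), which is negative exactly when \<open>B\<close> < \<open>A\<close>. Hence the minus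
  sign.\<close>

lemma relative_difference_reciprocals:
  fixes \<alpha> t A B :: real
  assumes "0 < t" "0 < \<alpha>" "0 < A" "0 \<le> B"
  shows "(1 / (t * (A + \<alpha>)) - 1 / (t * (\<alpha> + B))) / (1 / (t * (\<alpha> + B))) =
    - ((1 - B / A) * inverse (1 + \<alpha> * inverse A))"
proof -
  have nz: "t \<noteq> 0" "A \<noteq> 0" "A + \<alpha> \<noteq> 0" "\<alpha> + B \<noteq> 0" using assms by auto
  have "(1 / (t * (A + \<alpha>)) - 1 / (t * (\<alpha> + B))) / (1 / (t * (\<alpha> + B))) = (\<alpha> + B) / (A + \<alpha>) - 1"
    using nz by (subst diff_divide_distrib) simp
  also have "\<dots> = (B - A) / (A + \<alpha>)"
    using nz by (simp add: field_simps)
  also have "\<dots> = - ((A - B) / A * (A / (A + \<alpha>)))"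
    using nz by (simp add: minus_divide_left)
  also have "(A - B) / A = 1 - B / A"
    using nz by (simp add: diff_divide_distrib)
  also have "A / (A + \<alpha>) = inverse ((A + \<alpha>) / A)"
    by simp
  also have "(A + \<alpha>) / A = 1 + \<alpha> * inverse A"
    using nz by (simp add: divide_inverse distrib_right)
  finally show ?thesis .
qed

text \<open>The right-hand side is the negative of the product in the informal statement: the
  computation gives (\<open>Y powr \<gamma>\<close> - \<open>X powr \<gamma>\<close>)/(\<alpha> +
  \<open>X powr \<gamma>\<close>). The condition \<open>x \<noteq> 0\<close> gives \<rho> > 0, hence
  a positive foot, positive mass and a positive displacement.\<close>

theorem lemma4p8:
  fixes u0 :: "'a::euclidean_space \<Rightarrow> real"
    and \<alpha> M t \<rho> \<rho>\<^sub>0 \<eta>\<^sub>0 :: real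
    and m0 :: "real \<Rightarrow> real"
    and u U :: "real \<Rightarrow> 'a \<Rightarrow> real"
    and x :: 'a
  assumes "0 < \<alpha>" and "\<alpha> < 1"
    and "\<And>y. 0 \<le> u0 y"
    and "bounded (range u0)"
    and "integrable lebesgue u0"
    and "\<exists>y. u0 y \<noteq> 0"
    and "radially_nonincreasing u0"
    and "M = (LINT y|lebesgue. \<bar>u0 y\<bar>)"
    and "m0 = mass0 (radial_profile u0)"
    and "u = (\<lambda>s y. charac_solution \<alpha> (radial_profile u0) s (vol_var y))"
    and "U = source_solution \<alpha> M"
    and "0 < t" and "x \<noteq> 0"
    and "\<rho> = vol_var x"
    and "charac_pair \<alpha> (radial_profile u0) t \<rho> \<rho>\<^sub>0 \<eta>\<^sub>0"
  shows "(u t x powr \<alpha> - U t x powr \<alpha>) / U t x powr \<alpha> =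
    - ((1 - ((\<rho> / (\<rho> - \<rho>\<^sub>0)) / (M / m0 \<rho>\<^sub>0)) powr (\<alpha> / (1 - \<alpha>))) *
       inverse (1 + \<alpha> * ((\<rho> - \<rho>\<^sub>0) / (\<alpha> * m0 \<rho>\<^sub>0 * t powr (1 / \<alpha>))) powr (- (\<alpha> / (1 - \<alpha>)))))"
proof -
  define f where "f = radial_profile u0"
  define m where "m = m0 \<rho>\<^sub>0"
  define \<gamma> where "\<gamma> = \<alpha> / (1 - \<alpha>)"
  define X where "X = (\<rho> - \<rho>\<^sub>0) / (\<alpha> * m * t powr (1 / \<alpha>))"
  define Y where "Y = \<rho> * t powr (-1 / \<alpha>) / (\<alpha> * M)"
  note \<alpha> = assms(1,2)
  have f: "antimono_on {0..} f" "\<And>s. 0 \<le> f s"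
    using antimono_on_radial_profile[OF assms(7)] assms(3) by (auto simp: f_def radial_profile_def)
  have \<rho>: "0 < \<rho>" using vol_var_pos assms(13,14) by simp
  have p: "charac_pair \<alpha> f t \<rho> \<rho>\<^sub>0 \<eta>\<^sub>0" using assms(15) by (simp add: f_def)
  have m: "0 < m" and \<eta>: "0 < \<eta>\<^sub>0"
    using charac_pair_pos[OF f \<rho> p] assms(9) by (simp_all add: m_def f_def)
  have \<delta>: "\<rho> - \<rho>\<^sub>0 = \<alpha> * m * \<eta>\<^sub>0 powr (\<alpha> - 1) * t"
    using p assms(9) by (simp add: charac_pair_def m_def f_def)
  then have \<delta>_pos: "0 < \<rho> - \<rho>\<^sub>0" using \<alpha> m \<eta> \<open>0 < t\<close> by simp
  have X: "0 < X" unfolding X_def using \<delta>_pos \<alpha> m \<open>0 < t\<close> by simp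
  have M: "0 \<le> M" using assms(8) by simp
  then have Y: "0 \<le> Y" using \<rho> \<alpha> by (simp add: Y_def)

  \<comment> \<open>Both \<open>u\<close> and \<open>U\<close> are built from powers -1/\<alpha> of
    positive bases, so the power \<alpha> leaves plain reciprocals.\<close>
  have inv: "(a powr (-1 / \<alpha>)) powr \<alpha> = 1 / a" if "0 < a" for a
    using \<alpha> that powr_minus_divide[of a 1] by (simp add: powr_powr)
  have "u t x = (\<eta>\<^sub>0 powr (-\<alpha>) + \<alpha> * t) powr (-1 / \<alpha>)"
    using charac_solution_eq[OF \<alpha> f \<open>0 < t\<close> \<rho> p] assms(10,14) by (simp add: f_def)
  also have "\<eta>\<^sub>0 powr (-\<alpha>) = t * X powr \<gamma>"
    unfolding \<gamma>_def by (rule charac_slope_powr[OF \<alpha> m \<eta> \<open>0 < t\<close> \<delta> X_def])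
  finally have u: "u t x powr \<alpha> = 1 / (t * (X powr \<gamma> + \<alpha>))"
    using inv[of "t * X powr \<gamma> + \<alpha> * t"] \<alpha> \<open>0 < t\<close> X by (simp add: add_pos_pos algebra_simps)
  have "U t x = t powr (-1 / \<alpha>) * (\<alpha> + Y powr \<gamma>) powr (-1 / \<alpha>)"
    using assms(11,14) by (simp only: source_solution_def Y_def \<gamma>_def)
  then have "U t x powr \<alpha> =
      (t powr (-1 / \<alpha>)) powr \<alpha> * ((\<alpha> + Y powr \<gamma>) powr (-1 / \<alpha>)) powr \<alpha>"
    by (simp only: powr_mult)
  also have "\<dots> = 1 / t * (1 / (\<alpha> + Y powr \<gamma>))"
    using \<alpha> \<open>0 < t\<close> by (simp only: inv add_pos_nonneg powr_ge_zero)
  finally have U: "U t x powr \<alpha> = 1 / (t * (\<alpha> + Y powr \<gamma>))" by simp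

  \<comment> \<open>If \<open>M = 0\<close>, both sides are \<open>0\<close> because \<open>z / 0 = 0\<close>.\<close>
  have "(\<rho> / (\<rho> - \<rho>\<^sub>0)) / (M / m) = Y / X"
  proof (cases "M = 0")
    case False
    have "t powr (-1 / \<alpha>) = 1 / t powr (1 / \<alpha>)"
      using powr_minus_divide[of t "1 / \<alpha>"] by simp
    then show ?thesis using False \<alpha> m \<delta>_pos \<open>0 < t\<close> by (simp add: X_def Y_def)
  qed (simp add: Y_def)
  then have ratio: "((\<rho> / (\<rho> - \<rho>\<^sub>0)) / (M / m)) powr \<gamma> = Y powr \<gamma> / X powr \<gamma>"
    using X Y by (simp add: powr_divide)

  have "0 < X powr \<gamma>" using X by simp
  \<comment> \<open>Here \<open>A\<close> is \<open>X powr \<gamma>\<close>, positive because it is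
    a divisor, and \<open>B\<close> is \<open>Y powr \<gamma>\<close>.\<close>
  from relative_difference_reciprocals[OF \<open>0 < t\<close> \<open>0 < \<alpha>\<close> this powr_ge_zero[of Y \<gamma>]]
  have "(u t x powr \<alpha> - U t x powr \<alpha>) / U t x powr \<alpha> =
      - ((1 - ((\<rho> / (\<rho> - \<rho>\<^sub>0)) / (M / m)) powr \<gamma>) * inverse (1 + \<alpha> * X powr (- \<gamma>)))"
    unfolding u U ratio powr_minus .
  then show ?thesis unfolding X_def m_def \<gamma>_def .
qed

end
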